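(* Let $\ell\in\{0,1\}$. Let $\epsilon_n$ be Carlitz's $q$-Euler numbers, and set $$a_{\ell,n} = \frac{q^{2n+\ell} (1+q) (1+q^\ell)}{(1-q)(1+q^{2n+\ell}) (1+q^{2n+\ell+2})} - \frac{1}{1-q}\quad(n\ge 0),$$ $$b_{\ell,n} = -\frac{q^{2n+2\ell-1} (1-q^{2n}) (1-q^{2n+2\ell})}{(1-q)^2 (1+q^{2n+\ell-1})(1+q^{2n+\ell})^2(1+q^{2n+\ell+1})}\quad(n\ge 1).$$ Then $$\sum_{k\ge 0}\epsilon_{k+\ell} x^k = \cfrac{\epsilon_\ell}{1 + a_{\ell,0} x -\cfrac{b_{\ell,1} x^2}{1 + a_{\ell,1} x - \cfrac{b_{\ell,2} x^2}{1 + a_{\ell,2} x - \ddots}}}.$$ Further, the Favard orthogonal polynomials for the sequence $\{\epsilon_{k+\ell}\}_{k\ge 0}$ are the polynomials $$\mathcal{P}_{\ell,n}(z)=\frac{(-1)^n (q^{\ell+1};q)_n}{q^n (1-q)^n (-q^{n+\ell+1};q)_n}\sum_{k=0}^n\frac{\big(q^{-n};q\big)_k\big(-q^{n+\ell+1};q\big)_k\big(q(1-(1-q)z);q\big)_k}{(q;q)_k\,(q^{\ell+1};q)_k}\,q^k\qquad(n\ge 0).$$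
   Context: $q$ is an indeterminate; the ground field is $\mathbb{Q}(q)$. $(A;q)_N:=\prod_{k=0}^{N-1}(1-Aq^k)$. Carlitz's $q$-Euler numbers are $$\epsilon_n:=\frac{1}{(1-q)^n}\sum_{k=0}^n(-1)^k\binom{n}{k}\frac{1+q}{1+q^{k+1}}\qquad(n\ge 0).$$ The infinite (Jacobi) continued fraction is understood as a formal power series in $x$ over $\mathbb{Q}(q)$, namely the $x$-adic limit of its finite truncations. Favard orthogonal polynomials: if $\sum_{k\ge 0}\mu_k x^k$ has the Jacobi continued fraction expression $$\cfrac{\mu_0}{1 + a_{0} x -\cfrac{b_{1} x^2}{1 + a_{1} x - \cfrac{b_{2} x^2}{1 + a_{2} x - \ddots}}},$$ then the Favard orthogonal polynomials for $\{\mu_k\}_{k\ge 0}$ are the polynomials $p_n(z)$ defined by $p_0(z)=1$, $p_1(z)=a_0+z$, and $p_{n+1}(z)=(a_n+z)p_n(z)-b_np_{n-1}(z)$ for $n\ge 1$. *)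

theory Defs
  imports
    "HOL-Computational_Algebra.Formal_Power_Series"
    "HOL-Computational_Algebra.Fraction_Field"
    "HOL-Computational_Algebra.Polynomial"
begin

text \<open>The ground field \<open>\<rat>(q)\<close> is the fraction field \<open>rat poly fract\<close> of \<open>\<rat>[q]\<close>.\<close>

definition qq :: "rat poly fract" where
  "qq = Fract [:0, 1:] 1"

definition qpoch :: "'a::comm_ring_1 \<Rightarrow> 'a \<Rightarrow> nat \<Rightarrow> 'a" where
  "qpoch A q N = (\<Prod>k<N. 1 - A * q ^ k)"

definition q_euler :: "nat \<Rightarrow> rat poly fract" where
  "q_euler n = 1 / (1 - qq) ^ n *
     (\<Sum>k\<le>n. (-1) ^ k * of_nat (n choose k) * ((1 + qq) / (1 + qq ^ (k + 1))))"

text \<open>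
  \<open>jcf_denom a b j N\<close> is the truncation after \<open>N\<close> further levels of
  \<open>1 + a\<^sub>j x - b\<^sub>j\<^sub>+\<^sub>1 x\<^sup>2 / (1 + a\<^sub>j\<^sub>+\<^sub>1 x - \<dots>)\<close>.
  Each such series has constant term 1, so the divisions are by units.
  The value \<open>b 0\<close> is never used, neither here nor in \<open>favard_rec\<close>.
\<close>

fun jcf_denom :: "(nat \<Rightarrow> 'a::field) \<Rightarrow> (nat \<Rightarrow> 'a) \<Rightarrow> nat \<Rightarrow> nat \<Rightarrow> 'a fps" where
  "jcf_denom a b j 0 = 1 + fps_const (a j) * fps_X"
| "jcf_denom a b j (Suc N) =
     1 + fps_const (a j) * fps_X
       - fps_const (b (j + 1)) * fps_X ^ 2 / jcf_denom a b (j + 1) N"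

text \<open>The limit is taken in the metric of \<open>fps\<close>, whose topology is the \<open>x\<close>-adic one.\<close>

definition has_jacobi_cf :: "(nat \<Rightarrow> 'a::field) \<Rightarrow> (nat \<Rightarrow> 'a) \<Rightarrow> (nat \<Rightarrow> 'a) \<Rightarrow> bool" where
  "has_jacobi_cf \<mu> a b \<longleftrightarrow>
     (\<lambda>N. fps_const (\<mu> 0) / jcf_denom a b 0 N) \<longlonglongrightarrow> Abs_fps \<mu>"

fun favard_rec :: "(nat \<Rightarrow> 'a::comm_ring_1) \<Rightarrow> (nat \<Rightarrow> 'a) \<Rightarrow> nat \<Rightarrow> 'a poly" where
  "favard_rec a b 0 = 1"
| "favard_rec a b (Suc 0) = [:a 0, 1:]"
| "favard_rec a b (Suc (Suc n)) =
     [:a (Suc n), 1:] * favard_rec a b (Suc n) - smult (b (Suc n)) (favard_rec a b n)"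

definition favard_polys :: "(nat \<Rightarrow> 'a::field) \<Rightarrow> (nat \<Rightarrow> 'a poly) \<Rightarrow> bool" where
  "favard_polys \<mu> p \<longleftrightarrow>
     (\<exists>a b. has_jacobi_cf \<mu> a b \<and> (\<forall>n. p n = favard_rec a b n))"

definition a_coeff :: "nat \<Rightarrow> nat \<Rightarrow> rat poly fract" where
  "a_coeff l n =
     qq ^ (2*n + l) * (1 + qq) * (1 + qq ^ l) /
       ((1 - qq) * (1 + qq ^ (2*n + l)) * (1 + qq ^ (2*n + l + 2)))
     - 1 / (1 - qq)"

text \<open>Only meaningful for \<open>n \<ge> 1\<close>, where the subtractions in the exponents do not truncate.\<close>

definition b_coeff :: "nat \<Rightarrow> nat \<Rightarrow> rat poly fract" where
  "b_coeff l n =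
     - (qq ^ (2*n + 2*l - 1) * (1 - qq ^ (2*n)) * (1 - qq ^ (2*n + 2*l)) /
        ((1 - qq) ^ 2 * (1 + qq ^ (2*n + l - 1)) * (1 + qq ^ (2*n + l)) ^ 2
          * (1 + qq ^ (2*n + l + 1))))"

text \<open>The variable \<open>z\<close> is \<open>[:0, 1:]\<close>, and the Pochhammer symbol containing it is formed in \<open>\<rat>(q)[z]\<close>.\<close>

definition P_poly :: "nat \<Rightarrow> nat \<Rightarrow> rat poly fract poly" where
  "P_poly l n =
     smult ((-1) ^ n * qpoch (qq ^ (l + 1)) qq n /
              (qq ^ n * (1 - qq) ^ n * qpoch (- (qq ^ (n + l + 1))) qq n))
       (\<Sum>k\<le>n.
          smult (qpoch (qq powi (- int n)) qq k * qpoch (- (qq ^ (n + l + 1))) qq k /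
                   (qpoch qq qq k * qpoch (qq ^ (l + 1)) qq k) * qq ^ k)
            (qpoch ([:qq:] * (1 - [:1 - qq:] * [:0, 1:])) [:qq:] k))"

end

theory Submission
  imports Defs
begin

text \<open>
  Let \<open>L\<close> be the linear functional on polynomials in \<open>z\<close> with moments \<open>L(z ^ k) = \<epsilon>\<^sub>k\<^sub>+\<^sub>l\<close>.
  If the polynomials generated by the three-term recurrence with coefficients \<open>a\<close>, \<open>b\<close> satisfy
  \<open>L(z ^ m p\<^sub>n) = 0\<close> for \<open>m < n\<close>, then the series \<open>H\<^sub>n = \<Sum>\<^sub>k L(z ^ (n + k) p\<^sub>n) x ^ k\<close> satisfy
  \<open>b\<^sub>n H\<^sub>n\<^sub>-\<^sub>1 = (1 + a\<^sub>n x) H\<^sub>n - x\<^sup>2 H\<^sub>n\<^sub>+\<^sub>1\<close>, and unrolling this gives the continued fraction of \<open>H\<^sub>0\<close>.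

  Put \<open>w = 1 - (1 - q) z\<close>. For \<open>l = 0\<close> the definition of \<open>\<epsilon>\<^sub>n\<close> says \<open>L(w ^ m) = (1 + q) / (1 + q ^ (m + 1))\<close>,
  and induction on \<open>k\<close> gives \<open>L(w ^ m (q w; q)\<^sub>k)\<close> as a product; the case \<open>l = 1\<close> follows from
  \<open>z = (1 - w) / (1 - q)\<close>. Therefore \<open>L(w ^ m P\<^sub>n)\<close> is a terminating \<open>\<^sub>2\<phi>\<^sub>1\<close> that the
  q-Chu-Vandermonde formula evaluates to zero for \<open>m < n\<close>. The three-term recurrence for \<open>P\<^sub>n\<close>
  is checked coefficientwise in the basis \<open>(q w; q)\<^sub>k\<close>.
\<close>

subsection \<open>Orthogonality and Jacobi continued fractions\<close>

unbundle fps_syntax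

definition moment_fun :: "(nat \<Rightarrow> 'a::comm_ring_1) \<Rightarrow> 'a poly \<Rightarrow> 'a" where
  "moment_fun \<mu> p = (\<Sum>i\<le>degree p. coeff p i * \<mu> i)"

lemma moment_fun_eq_sum:
  assumes "degree p \<le> n"
  shows "moment_fun \<mu> p = (\<Sum>i\<le>n. coeff p i * \<mu> i)"
  unfolding moment_fun_def
  by (rule sum.mono_neutral_left) (use assms in \<open>auto simp: coeff_eq_0\<close>)

lemma moment_fun_0 [simp]: "moment_fun \<mu> 0 = 0"
  by (simp add: moment_fun_def)

lemma moment_fun_add [simp]: "moment_fun \<mu> (p + r) = moment_fun \<mu> p + moment_fun \<mu> r"
proof -
  define n where "n = max (degree p) (degree r)"
  have "degree p \<le> n" "degree r \<le> n" "degree (p + r) \<le> n"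
    by (auto simp: n_def degree_add_le)
  then show ?thesis
    by (simp add: moment_fun_eq_sum[of _ n] sum.distrib algebra_simps)
qed

lemma moment_fun_smult [simp]: "moment_fun \<mu> (smult c p) = c * moment_fun \<mu> p"
  by (simp add: moment_fun_eq_sum[of _ "degree p"] degree_smult_le sum_distrib_left mult.assoc)

lemma moment_fun_uminus [simp]: "moment_fun \<mu> (- p) = - moment_fun \<mu> p"
  using moment_fun_smult[of \<mu> "-1" p] by simp

lemma moment_fun_diff [simp]: "moment_fun \<mu> (p - r) = moment_fun \<mu> p - moment_fun \<mu> r"
  using moment_fun_add[of \<mu> p "- r"] by simp

lemma moment_fun_sum: "moment_fun \<mu> (\<Sum>i\<in>I. f i) = (\<Sum>i\<in>I. moment_fun \<mu> (f i))"
  by (induction I rule: infinite_finite_induct) auto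

lemma moment_fun_pCons: "moment_fun \<mu> (pCons c p) = c * \<mu> 0 + moment_fun (\<lambda>k. \<mu> (Suc k)) p"
  by (simp add: moment_fun_eq_sum[of "pCons c p" "Suc (degree p)"]
      moment_fun_eq_sum[of p "degree p"] degree_pCons_le sum.atMost_Suc_shift del: sum.atMost_Suc)

lemma moment_fun_monom [simp]: "moment_fun \<mu> (monom 1 n) = \<mu> n"
  by (induction n arbitrary: \<mu>) (simp_all add: moment_fun_pCons monom_0 monom_Suc)

lemma smult_sum_right: "smult c (\<Sum>i\<in>I. f i) = (\<Sum>i\<in>I. smult c (f i))"
  by (induction I rule: infinite_finite_induct) (auto simp: smult_add_right)

lemma monom_Suc_mult: "monom 1 (Suc n) * p = monom 1 n * pCons 0 p"
  by (simp add: monom_Suc)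

lemma pCons_mult: "[:c, 1 :: 'a::comm_semiring_1:] * p = smult c p + pCons 0 p"
  by simp

lemma jcf_denom_nth_0 [simp]: "jcf_denom a b j N $ 0 = 1"
  by (induction N arbitrary: j) (simp_all add: fps_divide_unit)

text \<open>
  A solution \<open>H\<close> of the three-term recurrence of the continued fraction satisfies \<open>E n / H n = D n\<close> for
  the formal limit \<open>D n\<close> of the denominators; every further level of truncation gains two powers
  of \<open>x\<close>.
\<close>

lemma jcf_denom_approx:
  fixes a b :: "nat \<Rightarrow> 'a::field"
  assumes rec: "\<And>n. E n = (1 + fps_const (a n) * fps_X) * H n - fps_X\<^sup>2 * H (Suc n)"
    and E_Suc: "\<And>n. E (Suc n) = fps_const (b (Suc n)) * H n"
  shows "fps_X ^ (2 * N + 2) dvd jcf_denom a b n N * H n - E n"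
proof (induction N arbitrary: n)
  case 0
  then show ?case by (simp add: rec power2_eq_square)
next
  case (Suc N)
  define D where "D = jcf_denom a b (Suc n) N"
  have "D $ 0 \<noteq> 0"
    by (simp add: D_def)
  then have D: "D * inverse D = 1" "is_unit D"
    by (simp_all add: inverse_mult_eq_1')
  have "jcf_denom a b n (Suc N) * H n - E n =
      fps_X\<^sup>2 * (H (Suc n) - fps_const (b (Suc n)) * inverse D * H n)"
    using \<open>D $ 0 \<noteq> 0\<close> by (simp add: rec D_def [symmetric] fps_divide_unit algebra_simps)
  also have "H (Suc n) - fps_const (b (Suc n)) * inverse D * H n =
      inverse D * (D * H (Suc n) - E (Suc n))"
    using D by (simp add: E_Suc algebra_simps)
  finally have eq: "jcf_denom a b n (Suc N) * H n - E n =
      fps_X\<^sup>2 * (inverse D * (D * H (Suc n) - E (Suc n)))" .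
  have "fps_X ^ (2 * Suc N + 2) = fps_X\<^sup>2 * (fps_X ^ (2 * N + 2) :: 'a fps)"
    by (simp add: power2_eq_square)
  also have "\<dots> dvd fps_X\<^sup>2 * (inverse D * (D * H (Suc n) - E (Suc n)))"
    using Suc.IH[of "Suc n"] by (intro mult_dvd_mono dvd_mult) (auto simp: D_def)
  finally show ?case
    by (simp only: eq)
qed

lemma fps_X_power_dvd_imp_nth_0:
  assumes "fps_X ^ m dvd (f :: 'a::comm_ring_1 fps)" "k < m"
  shows "f $ k = 0"
  using assms by (auto simp: dvd_def fps_X_power_mult_nth)

lemma cf_step_nth:
  "((1 + fps_const c * fps_X) * F - fps_X\<^sup>2 * G) $ k =
     F $ k + c * (if k = 0 then 0 else F $ (k - 1)) - (if k < 2 then 0 else G $ (k - 2))"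
  for F G :: "'a::comm_ring_1 fps"
  by (simp add: distrib_right fps_X_power_mult_nth mult.assoc)

text \<open>The converse of Favard's theorem. Orthogonality lets the coefficients of the series
  \<open>H n\<close> start at the moment of \<open>z ^ n * p n\<close>; the recurrence of
  \<open>p\<close> then becomes the recurrence required by \<open>jcf_denom_approx\<close>.\<close>

lemma has_jacobi_cf_if_orthogonal:
  fixes a b :: "nat \<Rightarrow> 'a::field"
  assumes orth: "\<And>n m. m < n \<Longrightarrow> moment_fun \<mu> (monom 1 m * favard_rec a b n) = 0"
  shows "has_jacobi_cf \<mu> a b"
proof -
  define p where "p = favard_rec a b"
  define H where "H n = Abs_fps (\<lambda>k. moment_fun \<mu> (monom 1 (n + k) * p n))" for n
  define E where
    "E n = (if n = 0 then fps_const (\<mu> 0) else fps_const (b n) * H (n - 1))" for n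
  have p_rec: "moment_fun \<mu> (monom 1 j * p (Suc (Suc m))) =
      a (Suc m) * moment_fun \<mu> (monom 1 j * p (Suc m))
        + moment_fun \<mu> (monom 1 (Suc j) * p (Suc m))
        - b (Suc m) * moment_fun \<mu> (monom 1 j * p m)" for j m
    by (simp add: p_def monom_Suc_mult pCons_mult right_diff_distrib distrib_left del: mult_pCons_left mult_pCons_right)
  have p1: "moment_fun \<mu> (monom 1 j * p (Suc 0)) = a 0 * \<mu> j + \<mu> (Suc j)" for j
  proof -
    have "p (Suc 0) = smult (a 0) 1 + monom 1 1"
      by (simp add: p_def monom_altdef)
    then show ?thesis
      by (simp add: algebra_simps mult_monom)
  qed
  have orth': "moment_fun \<mu> (monom 1 m * p n) = 0" if "m < n" for m n
    using orth[OF that] by (simp add: p_def)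
  have rec: "E n = (1 + fps_const (a n) * fps_X) * H n - fps_X\<^sup>2 * H (Suc n)" for n
  proof (rule fps_ext)
    fix k
    show "E n $ k = ((1 + fps_const (a n) * fps_X) * H n - fps_X\<^sup>2 * H (Suc n)) $ k"
    proof (cases n)
      case 0
      \<comment> \<open>Coefficient 1 vanishes because
        \<open>L(p 1) = a 0 * \<mu> 0 + \<mu> 1\<close> is zero by orthogonality; from coefficient 2
        on, \<open>p1\<close> makes everything cancel.\<close>
      have "p 0 = 1"
        by (simp add: p_def)
      then show ?thesis
        using p1[of "k - 1"] orth'[of 0 1] p1[of 0] 0
        unfolding cf_step_nth by (cases k) (auto simp: E_def H_def Suc_diff_le numeral_2_eq_2 add.commute)
    next
      case (Suc m)
      have "b n * moment_fun \<mu> (monom 1 (m + k) * p m) =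
        moment_fun \<mu> (monom 1 (n + k) * p n) + a n * moment_fun \<mu> (monom 1 (m + k) * p n)
          - moment_fun \<mu> (monom 1 (m + k) * p (Suc n))"
        using p_rec[of "m + k" m] Suc by simp
      \<comment> \<open>As \<open>n = m + 1\<close>, orthogonality kills the moment with
        \<open>p (n + 1)\<close> exactly for the exponents with \<open>k < 2\<close>, and the one
        with \<open>p n\<close> below for \<open>k = 0\<close>. These are the cut-offs of the shifts
        by \<open>x ^ 2\<close> and \<open>x\<close>.\<close>
      moreover have "moment_fun \<mu> (monom 1 (m + k) * p (Suc n)) =
         (if k < 2 then 0 else H (Suc n) $ (k - 2))"
        using Suc by (auto simp: orth' H_def intro!: arg_cong[where f = "\<lambda>i. moment_fun \<mu> (monom 1 i * p (Suc (Suc m)))"])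
      moreover have "moment_fun \<mu> (monom 1 (m + k) * p n) =
         (if k = 0 then 0 else H n $ (k - 1))"
        using Suc by (auto simp: orth' H_def intro!: arg_cong[where f = "\<lambda>i. moment_fun \<mu> (monom 1 i * p (Suc m))"])
      ultimately have "b n * H m $ k = H n $ k + a n * (if k = 0 then 0 else H n $ (k - 1))
          - (if k < 2 then 0 else H (Suc n) $ (k - 2))"
        by (simp add: H_def)
      then show ?thesis
        unfolding cf_step_nth by (simp add: E_def Suc)
    qed
  qed
  have E_Suc: "E (Suc n) = fps_const (b (Suc n)) * H n" for n
    by (simp add: E_def)
  have H0: "H 0 = Abs_fps \<mu>"
    by (simp add: H_def p_def)
  have approx: "fps_X ^ (2 * N + 2) dvd Abs_fps \<mu> - fps_const (\<mu> 0) / jcf_denom a b 0 N" for N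
  proof -
    define D where "D = jcf_denom a b 0 N"
    have "D $ 0 \<noteq> 0"
      by (simp add: D_def)
    then have "Abs_fps \<mu> - fps_const (\<mu> 0) / D = inverse D * (D * H 0 - E 0)"
      by (simp add: H0 E_def fps_divide_unit algebra_simps inverse_mult_eq_1')
    then show ?thesis
      using jcf_denom_approx[of E a H b N 0, OF rec E_Suc] by (simp add: D_def)
  qed
  show ?thesis
    unfolding has_jacobi_cf_def
  proof (rule tendsto_fpsI)
    fix k
    show "\<forall>\<^sub>F N in sequentially. (fps_const (\<mu> 0) / jcf_denom a b 0 N) $ k = Abs_fps \<mu> $ k"
      using eventually_ge_at_top[of k]
    proof eventually_elim
      case (elim N)
      show ?case
        using fps_X_power_dvd_imp_nth_0[OF approx[of N], of k] elim by simp
    qed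
  qed
qed

subsection \<open>The q-Chu-Vandermonde formula\<close>

lemma qpoch_0 [simp]: "qpoch A q 0 = 1"
  by (simp add: qpoch_def)

lemma qpoch_Suc: "qpoch A q (Suc n) = qpoch A q n * (1 - A * q ^ n)"
  by (simp add: qpoch_def)

lemma qpoch_rec: "qpoch A q (Suc n) = (1 - A) * qpoch (A * q) q n"
  by (simp add: qpoch_def prod.lessThan_Suc_shift mult.assoc del: prod.lessThan_Suc)

text \<open>Both sides are \<open>qpoch A q (k + 2)\<close>, split at the front and at the
  back.\<close>

lemma qpoch_shift2: "(1 - A) * qpoch (A * q) q (Suc k) = qpoch A q k * (1 - A * q ^ k) * (1 - A * q ^ Suc k)"
  by (simp only: qpoch_rec [symmetric]) (simp only: qpoch_Suc)

lemma qpoch_nonzero: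
  assumes "\<And>k. k < n \<Longrightarrow> A * q ^ k \<noteq> 1"
  shows "qpoch A q n \<noteq> (0 :: 'a::field)"
  using assms by (force simp: qpoch_def)

text \<open>The factor with index \<open>n\<close> is zero. This terminates the hypergeometric sums,
  so their range may be extended beyond \<open>n\<close>.\<close>

lemma qpoch_inverse_power_eq_0:
  assumes "q \<noteq> (0 :: 'a::field)" "n < k"
  shows "qpoch (inverse q ^ n) q k = 0"
  using assms by (force simp: qpoch_def power_inverse intro!: prod_zero)

text \<open>All terms share the factor \<open>qpoch (inverse q ^ n) q k\<close>; with
  \<open>A = inverse q ^ Suc n\<close> what remains is
  \<open>1 - A = (1 - A * q ^ (k + 1)) - A * (1 - q ^ (k + 1))\<close>.\<close>

lemma qpoch_inverse_power_Suc:
  assumes q: "q \<noteq> (0 :: 'a::field)"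
  shows "qpoch (inverse q ^ Suc n) q (Suc k) =
    qpoch (inverse q ^ n) q (Suc k) - inverse q ^ Suc n * (1 - q ^ Suc k) * qpoch (inverse q ^ n) q k"
proof -
  have "inverse q ^ Suc n * q = inverse q ^ n"
    using q by simp
  then have "qpoch (inverse q ^ Suc n) q (Suc k) = (1 - inverse q ^ Suc n) * qpoch (inverse q ^ n) q k"
    by (simp only: qpoch_rec)
  moreover have "inverse q ^ n * q ^ k = inverse q ^ Suc n * q ^ Suc k"
    using q by simp
  then have "qpoch (inverse q ^ n) q (Suc k) = qpoch (inverse q ^ n) q k * (1 - inverse q ^ Suc n * q ^ Suc k)"
    by (simp only: qpoch_Suc)
  ultimately show ?thesis
    by (simp add: algebra_simps del: power_Suc)
qed

text \<open>The terminating series \<open>2phi1(q^(-n), b; c; q, q)\<close>.\<close>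

definition chu_sum :: "'a::field \<Rightarrow> nat \<Rightarrow> 'a \<Rightarrow> 'a \<Rightarrow> 'a" where
  "chu_sum q n b c =
     (\<Sum>k\<le>n. qpoch (inverse q ^ n) q k * qpoch b q k / (qpoch q q k * qpoch c q k) * q ^ k)"

text \<open>Termwise application of \<open>qpoch_inverse_power_Suc\<close>: its factor
  \<open>1 - q ^ (k + 1)\<close> cancels the last factor of \<open>qpoch q q (k + 1)\<close>, and
  splitting off the first factors of the other symbols turns \<open>b\<close>, \<open>c\<close> into
  \<open>b * q\<close>, \<open>c * q\<close>.\<close>

lemma chu_sum_Suc:
  assumes q: "q \<noteq> 0" "\<And>k. q ^ Suc k \<noteq> 1"
    and c: "\<And>k. k \<le> n \<Longrightarrow> c * q ^ k \<noteq> 1"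
  shows "chu_sum q (Suc n) b c =
    chu_sum q n b c - inverse q ^ n * (1 - b) / (1 - c) * chu_sum q n (b * q) (c * q)"
proof -
  define t where "t A b c k = qpoch A q k * qpoch b q k / (qpoch q q k * qpoch c q k) * q ^ k" for A b c k
  define A where "A = inverse q ^ n"
  have qk: "qpoch q q k \<noteq> 0" for k
    using q by (intro qpoch_nonzero) (simp flip: power_Suc)
  have ck: "qpoch (c * q) q k \<noteq> 0" if "k \<le> n" for k
    using c[of "Suc _"] that by (intro qpoch_nonzero) (simp add: mult.assoc)
  have c0: "1 - c \<noteq> 0"
    using c[of 0] by auto
  \<comment> \<open>Abstract form of the cancellation; \<open>u\<close> stands for
    \<open>1 - q ^ (k + 1)\<close>.\<close>
  have cancel: "A * inverse q * u * P * (\<beta> * B) / (Q * u * (\<gamma> * C)) * (q * x)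
      = A * \<beta> / \<gamma> * (P * B / (Q * C) * x)" if "u \<noteq> 0" for u P \<beta> B Q \<gamma> C x
  proof -
    have "inverse q * q = 1" "u * inverse u = 1"
      using that q(1) by simp_all
    then show ?thesis
      unfolding divide_inverse inverse_mult_distrib by algebra
  qed
  have step: "t (inverse q ^ Suc n) b c (Suc k) =
     t A b c (Suc k) - A * (1 - b) / (1 - c) * t A (b * q) (c * q) k" if "k \<le> n" for k
  proof -
    have "1 - q * q ^ k \<noteq> 0"
      using q(2)[of k] by auto
    then have "inverse q ^ Suc n * (1 - q ^ Suc k) * qpoch A q k * qpoch b q (Suc k)
           / (qpoch q q (Suc k) * qpoch c q (Suc k)) * q ^ Suc k
        = A * (1 - b) / (1 - c) * t A (b * q) (c * q) k"
      unfolding qpoch_rec[of b] qpoch_rec[of c] qpoch_Suc[of q] t_def A_def [symmetric] power_Suc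
      using cancel by (simp only: mult.commute[of "inverse q" A])
    then show ?thesis
      unfolding t_def qpoch_inverse_power_Suc[OF q(1)] A_def
      by (simp add: left_diff_distrib diff_divide_distrib mult.assoc)
  qed
  have "chu_sum q (Suc n) b c = 1 + (\<Sum>k\<le>n. t (inverse q ^ Suc n) b c (Suc k))"
    unfolding chu_sum_def t_def by (subst sum.atMost_Suc_shift) simp
  also have "\<dots> = 1 + (\<Sum>k\<le>n. t A b c (Suc k)) - A * (1 - b) / (1 - c) * (\<Sum>k\<le>n. t A (b * q) (c * q) k)"
    using step by (simp add: sum_subtractf sum_distrib_left del: power_Suc)
  also have "1 + (\<Sum>k\<le>n. t A b c (Suc k)) = (\<Sum>k\<le>Suc n. t A b c k)"
    by (subst sum.atMost_Suc_shift) (simp add: t_def)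
  also have "\<dots> = (\<Sum>k\<le>n. t A b c k)"
    by (simp add: t_def A_def qpoch_inverse_power_eq_0[OF q(1)])
  finally show ?thesis
    by (simp add: chu_sum_def t_def A_def)
qed

text \<open>The product form of \<open>b ^ n * qpoch (c / b) q n\<close> avoids dividing by
  \<open>b\<close> and shows the zeros \<open>b = c * q ^ i\<close>.\<close>

lemma chu_vandermonde:
  assumes q: "q \<noteq> (0 :: 'a::field)" "\<And>k. q ^ Suc k \<noteq> 1"
    and c: "\<And>k. c * q ^ k \<noteq> 1"
  shows "chu_sum q n b c = (\<Prod>i<n. b - c * q ^ i) / qpoch c q n"
  using c
proof (induction n arbitrary: b c)
  case 0
  then show ?case by (simp add: chu_sum_def)
next
  case (Suc n)
  have c0: "1 - c \<noteq> 0" "1 - c * q ^ n \<noteq> 0"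
    using Suc.prems[of 0] Suc.prems[of n] by auto
  have cn: "qpoch c q n \<noteq> 0"
    using Suc.prems by (intro qpoch_nonzero) auto
  have cq: "(1 - c) * qpoch (c * q) q n = qpoch c q n * (1 - c * q ^ n)"
    by (simp flip: qpoch_Suc qpoch_rec)
  have "c * q * q ^ k \<noteq> 1" for k
    using Suc.prems[of "Suc k"] by (simp add: mult.assoc)
  then have "chu_sum q n (b * q) (c * q) = (\<Prod>i<n. b * q - c * q * q ^ i) / qpoch (c * q) q n"
    by (intro Suc.IH)
  also have "(\<Prod>i<n. b * q - c * q * q ^ i) = q ^ n * (\<Prod>i<n. b - c * q ^ i)"
  proof -
    have "(\<Prod>i<n. b * q - c * q * q ^ i) = (\<Prod>i<n. q * (b - c * q ^ i))"
      by (intro prod.cong) (auto simp: algebra_simps)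
    then show ?thesis
      by (simp add: prod.distrib)
  qed
  finally have "inverse q ^ n * (1 - b) / (1 - c) * chu_sum q n (b * q) (c * q) =
      (1 - b) * (\<Prod>i<n. b - c * q ^ i) / ((1 - c) * qpoch (c * q) q n)"
    using q(1) by (simp add: power_inverse)
  then have "chu_sum q (Suc n) b c =
      (\<Prod>i<n. b - c * q ^ i) / qpoch c q n
        - (1 - b) * (\<Prod>i<n. b - c * q ^ i) / (qpoch c q n * (1 - c * q ^ n))"
    using Suc by (simp add: chu_sum_Suc q cq del: power_Suc)
  \<comment> \<open>Over the common denominator the numerators combine by
    \<open>(1 - c * q ^ n) - (1 - b) = b - c * q ^ n\<close>.\<close>
  also have "\<dots> = (\<Prod>i<n. b - c * q ^ i) * (b - c * q ^ n) / (qpoch c q n * (1 - c * q ^ n))"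
    using c0 cn by (simp add: divide_simps) (simp add: algebra_simps)
  finally show ?case
    by (simp add: qpoch_Suc)
qed

subsection \<open>The three-term recurrence\<close>

text \<open>
  In the next three lemmas \<open>N\<close>, \<open>K\<close>, \<open>s\<close> stand for \<open>q ^ n\<close>, \<open>q ^ k\<close>, \<open>q ^ l\<close>; they compare the
  coefficients of \<open>(q w; q)\<^sub>k\<^sub>+\<^sub>1\<close> and of \<open>(q w; q)\<^sub>0\<close> in the recurrence of the polynomials
  \<open>P_poly l n\<close>.
\<close>

lemma three_term_poly:
  fixes q s N K y :: "'a::idom"
  assumes y: "y = N^2 * s"
  shows "- ((1 - s*q*N) * (N*q - 1) * (1 + N*s*q*K) * (1 + N*s*q^2*K) * K * (1+y))
   = y*(1+q)*(1+s)*(1+y*q) * q^2*K * (N-K)*(1 + N*s*q*K)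
     - (N-K)*(1 + N*s*q*K) * (1+y)*(1+y*q)*(1+y*q^2)
     + (1-q*K)*(1-s*q*K) * N * (1+y)*(1+y*q)*(1+y*q^2)
     + q^2*N^2*K*s^2*(N-K)*(N-q*K)*(1+N)*(1+s*N)*(1+y*q^2)"
  unfolding y by algebra

lemma three_term_frac:
  fixes q s N K y :: "'a::field"
  assumes y: "y = N^2 * s"
    and nz: "q \<noteq> 0" "N \<noteq> 0" "K \<noteq> 0" "1 - q \<noteq> 0" "1 + y \<noteq> 0" "1 + y*q \<noteq> 0" "1 + y*q^2 \<noteq> 0"
  shows "- ((1 - s*q*N) * (1 - 1/(N*q)) * (1 + N*s*q*K) * (1 + N*s*q^2*K) / ((1-q)*(1+y*q)*(1+y*q^2)))
   = (y*(1+q)*(1+s) / ((1-q)*(1+y)*(1+y*q^2)) - 1 / (1-q) + (1 - 1/(q^2*K)) / (1-q))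
        * (q*(1-K/N)*(1 + N*s*q*K))
     + 1/(q*K)/(1-q) * ((1-q*K)*(1-s*q*K))
     - (- (q*N*s^2*(N-K)*(N-q*K)*(1+N)*(1+s*N) / ((1-q)*(1+y)*(1+y*q))))" (is "?L = ?R")
proof -
  define d e f g where "d = 1 + y" and "e = 1 + y*q" and "f = 1 + y*q^2" and "g = 1 - q"
  have nz': "d \<noteq> 0" "e \<noteq> 0" "f \<noteq> 0" "g \<noteq> 0"
    using nz by (auto simp: d_def e_def f_def g_def)
  \<comment> \<open>A common denominator of all terms; the numerators over it form
    \<open>three_term_poly\<close>.\<close>
  define D where "D = q*N*K*g*d*e*f"
  have L: "?L = - ((1 - s*q*N) * (N*q - 1) * (1 + N*s*q*K) * (1 + N*s*q^2*K) * K * d) / D"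
  proof -
    have "1 - 1/(N*q) = (N*q - 1)/(N*q)"
      using nz by (simp add: diff_divide_distrib)
    then show ?thesis
      unfolding d_def [symmetric] e_def [symmetric] f_def [symmetric] g_def [symmetric] D_def
      using nz nz' by simp (simp add: ac_simps)
  qed
  have R1: "(y*(1+q)*(1+s) / (g*d*f) - 1 / g + (1 - 1/(q^2*K)) / g)
        * (q*(1-K/N)*(1 + N*s*q*K)) =
      (y*(1+q)*(1+s)*e * q^2*K * (N-K)*(1 + N*s*q*K) - (N-K)*(1 + N*s*q*K) * d*e*f) / D"
  proof -
    have "y*(1+q)*(1+s) / (g*d*f) - 1 / g + (1 - 1/(q^2*K)) / g
      = y*(1+q)*(1+s) / (g*d*f) - 1/(q^2*K) / g"
      by (simp add: diff_divide_distrib)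
    also have "\<dots> = (y*(1+q)*(1+s) * q^2 * K - d*f) / (q^2*K*g*d*f)"
      using nz nz' by (simp add: diff_divide_distrib) (simp add: ac_simps)
    finally have 1: "y*(1+q)*(1+s) / (g*d*f) - 1 / g + (1 - 1/(q^2*K)) / g
      = (y*(1+q)*(1+s) * q^2 * K - d*f) / (q^2*K*g*d*f)" .
    have 2: "1 - K/N = (N - K)/N"
      using nz by (simp add: diff_divide_distrib)
    have 3: "y*(1+q)*(1+s)*e * q^2*K * (N-K)*(1 + N*s*q*K) - (N-K)*(1 + N*s*q*K) * d*e*f
      = (y*(1+q)*(1+s) * q^2 * K - d*f) * ((N-K) * (1 + N*s*q*K)) * e"
      by algebra
    show ?thesis
      unfolding 1 2 3 D_def using nz nz' by (simp add: power2_eq_square)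
  qed
  have R2: "1/(q*K)/g * ((1-q*K)*(1-s*q*K)) = (1-q*K)*(1-s*q*K) * N * d*e*f / D"
    using nz nz' by (simp add: D_def)
  have R3: "q*N*s^2*(N-K)*(N-q*K)*(1+N)*(1+s*N) / (g*d*e)
      = q^2*N^2*K*s^2*(N-K)*(N-q*K)*(1+N)*(1+s*N)*f / D"
    using nz nz' by (simp add: D_def power2_eq_square) (simp add: ac_simps)
  have "?R = (y*(1+q)*(1+s)*e * q^2*K * (N-K)*(1 + N*s*q*K)
     - (N-K)*(1 + N*s*q*K) * d*e*f
     + (1-q*K)*(1-s*q*K) * N * d*e*f
     + q^2*N^2*K*s^2*(N-K)*(N-q*K)*(1+N)*(1+s*N)*f) / D"
    unfolding d_def [symmetric] e_def [symmetric] f_def [symmetric] g_def [symmetric] R1 R2 R3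
    by (simp add: add_divide_distrib)
  then show ?thesis
    unfolding L using three_term_poly[OF y, of q K] by (simp add: d_def e_def f_def)
qed

lemma three_term_frac_0:
  fixes q s N y :: "'a::field"
  assumes y: "y = N^2 * s"
    and nz: "q \<noteq> 0" "1 - q \<noteq> 0" "1 + y \<noteq> 0" "1 + y*q \<noteq> 0" "1 + y*q^2 \<noteq> 0"
  shows "- ((1 - s*q*N) * (1 + s*q*N) / (q*(1-q)*(1+y*q)*(1+y*q^2)))
   = y*(1+q)*(1+s) / ((1-q)*(1+y)*(1+y*q^2)) - 1 / (1-q) + (1 - 1/q) / (1-q)
     - N^2*s^2*(1-N^2) / ((1-q)*(1+y)*(1+y*q))" (is "?L = ?R")
proof -
  define d e f g where "d = 1 + y" and "e = 1 + y*q" and "f = 1 + y*q^2" and "g = 1 - q"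
  have nz': "d \<noteq> 0" "e \<noteq> 0" "f \<noteq> 0" "g \<noteq> 0"
    using nz by (auto simp: d_def e_def f_def g_def)
  define D where "D = q*g*d*e*f"
  have L: "?L = - ((1 - s*q*N) * (1 + s*q*N) * d) / D"
    unfolding d_def [symmetric] e_def [symmetric] f_def [symmetric] g_def [symmetric] D_def
    using nz nz' by simp
  have "?R = (q*y*(1+q)*(1+s)*e - d*e*f - q*N^2*s^2*(1-N^2)*f) / D"
    unfolding d_def [symmetric] e_def [symmetric] f_def [symmetric] g_def [symmetric] D_def
    using nz nz' by (simp add: diff_divide_distrib) (simp add: ac_simps)
  also have "q*y*(1+q)*(1+s)*e - d*e*f - q*N^2*s^2*(1-N^2)*f = - ((1 - s*q*N) * (1 + s*q*N) * d)"
    unfolding d_def e_def f_def y by algebra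
  finally show ?thesis
    unfolding L ..
qed

section \<open>Non-vanishing of the denominators in \<open>\<rat>(q)\<close>\<close>

lemma qq_power: "qq ^ k = Fract (monom 1 k) 1"
  by (induction k) (simp_all add: qq_def monom_0 One_fract_def monom_Suc flip: one_pCons)

lemma qq_nonzero [simp]: "qq \<noteq> 0"
  by (simp add: qq_def Zero_fract_def eq_fract)

text \<open>The polynomial takes the value 2 at 1.\<close>

lemma one_plus_qq_power_nonzero [simp]: "1 + qq ^ k \<noteq> 0"
proof -
  have "poly (1 + monom 1 k) 1 \<noteq> (0 :: rat)"
    by (simp add: poly_monom)
  then have "1 + monom 1 k \<noteq> (0 :: rat poly)"
    by force
  then show ?thesis
    by (simp add: qq_power One_fract_def Zero_fract_def eq_fract)
qed

lemma qq_power_neq_1 [simp]: "k > 0 \<Longrightarrow> qq ^ k \<noteq> 1"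
proof
  assume k: "k > 0" "qq ^ k = 1"
  then have "monom 1 k = (1 :: rat poly)"
    by (simp add: qq_power One_fract_def eq_fract)
  then have "degree (monom (1 :: rat) k) = degree (1 :: rat poly)"
    by simp
  then show False
    using k by (simp add: degree_monom_eq)
qed

lemma one_plus_qq_nonzero [simp]: "1 + qq \<noteq> 0" "1 - qq \<noteq> 0" "qq \<noteq> 1"
  using one_plus_qq_power_nonzero[of 1] qq_power_neq_1[of 1] by auto

lemma qpoch_qq_power_nonzero [simp]: "qpoch (qq ^ Suc l) qq n \<noteq> 0"
proof (rule qpoch_nonzero)
  fix k
  have "qq ^ (Suc l + k) \<noteq> 1"
    by (rule qq_power_neq_1) simp
  then show "qq ^ Suc l * qq ^ k \<noteq> 1"
    by (simp only: power_add not_False_eq_True)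
qed

lemma minus_qq_power_mult_neq_1 [simp]: "- (qq ^ l) * qq ^ k \<noteq> 1"
proof -
  have "1 + qq ^ (l + k) \<noteq> 0"
    by (rule one_plus_qq_power_nonzero)
  then have "1 \<noteq> - (qq ^ (l + k))"
    by (simp only: eq_neg_iff_add_eq_0 not_False_eq_True)
  then show ?thesis
    by (simp only: power_add mult_minus_left)
qed

lemma one_minus_qq_power_nonzero [simp]: "1 - qq ^ Suc k \<noteq> 0"
  using qq_power_neq_1[of "Suc k"] by (simp del: qq_power_neq_1)

text \<open>The variable \<open>w = 1 - (1 - q) z\<close>, in which the moments become \<open>(1 + q) / (1 + q ^ (m + 1))\<close>.\<close>

definition W_poly :: "rat poly fract poly" where
  "W_poly = [:1, qq - 1:]"

definition phi_poly :: "nat \<Rightarrow> rat poly fract poly" where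
  "phi_poly k = qpoch (smult qq W_poly) [:qq:] k"

definition lead_fac :: "nat \<Rightarrow> nat \<Rightarrow> rat poly fract" where
  "lead_fac l n = (-1) ^ n * qpoch (qq ^ (l + 1)) qq n /
     (qq ^ n * (1 - qq) ^ n * qpoch (- (qq ^ (n + l + 1))) qq n)"

definition R_coeff :: "nat \<Rightarrow> nat \<Rightarrow> nat \<Rightarrow> rat poly fract" where
  "R_coeff l n k = qpoch (inverse qq ^ n) qq k * qpoch (- (qq ^ (n + l + 1))) qq k /
     (qpoch qq qq k * qpoch (qq ^ (l + 1)) qq k) * qq ^ k"

lemma phi_poly_Suc: "phi_poly (Suc k) = phi_poly k - smult (qq ^ Suc k) (W_poly * phi_poly k)"
proof -
  have "phi_poly (Suc k) = phi_poly k * (1 - smult (qq ^ Suc k) W_poly)"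
    by (simp add: phi_poly_def qpoch_Suc poly_const_pow mult.commute)
  then show ?thesis
    by (simp add: algebra_simps)
qed

text \<open>Multiplication by \<open>w\<close> is bidiagonal in the basis \<open>phi_poly\<close>,
  which makes coefficient comparison possible.\<close>

lemma W_phi_poly: "W_poly * phi_poly k = smult (1 / qq ^ Suc k) (phi_poly k - phi_poly (Suc k))"
  unfolding phi_poly_Suc by simp

text \<open>The free bound \<open>M\<close> lets polynomials of different index be summed over the
  same range.\<close>

lemma P_poly_eq_sum_phi:
  assumes "n \<le> M"
  shows "P_poly l n = (\<Sum>k\<le>M. smult (lead_fac l n * R_coeff l n k) (phi_poly k))"
proof -
  have W: "[:qq:] * (1 - [:1 - qq:] * [:0, 1:]) = smult qq W_poly"
    by (simp add: W_poly_def one_pCons)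
  have inv: "qq powi (- int n) = inverse qq ^ n"
    by (simp add: power_int_minus power_inverse)
  have "P_poly l n = (\<Sum>k\<le>n. smult (lead_fac l n * R_coeff l n k) (phi_poly k))"
    unfolding P_poly_def W inv phi_poly_def lead_fac_def R_coeff_def by (simp add: smult_sum_right)
  also have "\<dots> = (\<Sum>k\<le>M. smult (lead_fac l n * R_coeff l n k) (phi_poly k))"
    by (rule sum.mono_neutral_left)
      (use assms in \<open>auto simp: R_coeff_def qpoch_inverse_power_eq_0 simp del: inverse_eq_divide power_inverse\<close>)
  finally show ?thesis .
qed

section \<open>Ratios of prefactors and coefficients of \<open>P_poly\<close>\<close>

lemma lead_fac_Suc:
  fixes l n :: nat
  defines "s \<equiv> qq ^ l" and "N \<equiv> qq ^ n"
  shows "lead_fac l (Suc n) =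
    - ((1 - s*qq*N) * (1 + s*qq*N) / (qq*(1-qq)*(1+N^2*s*qq)*(1+N^2*s*qq^2))) * lead_fac l n"
proof -
  define A where "A = - (s * qq * N)"
  have s1: "qq ^ (l + 1) = s * qq" "- (qq ^ (n + l + 1)) = A" "- (qq ^ (Suc n + l + 1)) = A * qq"
    by (simp_all add: A_def s_def N_def power_add)
  have "1 + qq ^ (n + l + 1) \<noteq> 0" "1 + qq ^ (2 * n + l + 1) \<noteq> 0" "1 + qq ^ (2 * n + l + 2) \<noteq> 0"
    by (rule one_plus_qq_power_nonzero)+
  then have nz: "1 - A \<noteq> 0" "1 + N^2*s*qq \<noteq> 0" "1 + N^2*s*qq^2 \<noteq> 0"
    by (simp_all add: A_def s_def N_def power_add power_mult power2_eq_square ac_simps)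
  have AN: "1 - A * qq ^ n = 1 + N^2*s*qq" "1 - A * qq ^ Suc n = 1 + N^2*s*qq^2"
    by (simp_all add: A_def N_def power2_eq_square ac_simps)
  \<comment> \<open>In this symbol both the base and the length move with \<open>n\<close>: two
    factors enter at the back and one leaves at the front.\<close>
  have shift: "qpoch (A * qq) qq (Suc n) = qpoch A qq n * (1 + N^2*s*qq) * (1 + N^2*s*qq^2) / (1 - A)"
    using qpoch_shift2[of A qq n] nz unfolding AN by (simp add: eq_divide_eq mult.commute)
  have lead: "lead_fac l n = (-1) ^ n * qpoch (s * qq) qq n / (qq ^ n * (1 - qq) ^ n * qpoch A qq n)"
    unfolding lead_fac_def s1 ..
  have "lead_fac l (Suc n) = (-1) ^ Suc n * (qpoch (s * qq) qq n * (1 - s * qq * N)) /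
     (qq ^ Suc n * (1 - qq) ^ Suc n * (qpoch A qq n * (1 + N^2*s*qq) * (1 + N^2*s*qq^2) / (1 - A)))"
    unfolding lead_fac_def s1 shift qpoch_Suc[of "s * qq"] N_def ..
  also have "1 - A = 1 + s*qq*N"
    by (simp add: A_def)
  finally show ?thesis
    unfolding lead by (simp add: ac_simps)
qed

text \<open>Allows every term of the recurrence to be written with the prefactor
  \<open>lead_fac l n\<close>. At \<open>n = 0\<close> both sides vanish through
  \<open>1 - q ^ (2 * n)\<close>.\<close>

lemma b_coeff_lead_fac:
  fixes l n :: nat
  defines "s \<equiv> qq ^ l" and "N \<equiv> qq ^ n" and "y \<equiv> qq ^ (2 * n + l)"
  shows "b_coeff l n * lead_fac l (n - 1) =
    N^2*s^2*(1-N^2) / ((1-qq)*(1+y)*(1+y*qq)) * lead_fac l n"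
proof (cases n)
  case 0
  then show ?thesis
    by (simp add: b_coeff_def N_def)
next
  case (Suc m)
  define M where "M = qq ^ m"
  define z where "z = qq ^ (2 * m + l)"
  define d where "d = 1 + z*qq"
  define e where "e = 1 + y"
  define f where "f = 1 + y*qq"
  define h where "h = 1 - s*qq*M"
  define i where "i = 1 + s*qq*M"
  define g where "g = 1 - qq"
  have y: "y = M^2*s*qq^2" "z = M^2*s"
    by (simp_all add: y_def s_def M_def z_def Suc power_add power_mult power2_eq_square ac_simps)
  have nz: "d \<noteq> 0" "e \<noteq> 0" "f \<noteq> 0" "h \<noteq> 0" "i \<noteq> 0" "g \<noteq> 0"
  proof -
    show "d \<noteq> 0"
      using one_plus_qq_power_nonzero[of "2 * m + l + 1"] by (simp add: d_def z_def mult.commute)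
    show "e \<noteq> 0"
      using one_plus_qq_power_nonzero[of "2 * n + l"] by (simp add: e_def y_def)
    show "f \<noteq> 0"
      using one_plus_qq_power_nonzero[of "2 * n + l + 1"] by (simp add: f_def y_def mult.commute)
    show "h \<noteq> 0"
      using qq_power_neq_1[of "l + m + 1"] by (simp add: h_def s_def M_def power_add ac_simps)
    show "i \<noteq> 0"
      using one_plus_qq_power_nonzero[of "l + m + 1"] by (simp add: i_def s_def M_def power_add ac_simps)
  qed (simp add: g_def)
  have "b_coeff l n = - (z * s * qq * (1 - N^2) * (1 - s^2 * N^2) / (g^2 * d * e^2 * f))"
  proof -
    have 1: "qq ^ (2*n + 2*l - 1) = z * s * qq" "qq ^ (2*n) = N^2" "qq ^ (2*n + 2*l) = s^2 * N^2"
      "qq ^ (2*n + l - 1) = z * qq" "qq ^ (2*n + l) = y" "qq ^ (2*n + l + 1) = y * qq"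
      by (simp_all add: s_def N_def y_def z_def Suc power_add power_mult power2_eq_square ac_simps
           flip: power_mult_distrib)
    show ?thesis
      unfolding b_coeff_def 1 by (simp add: d_def e_def f_def g_def)
  qed
  \<comment> \<open>The product \<open>h * i\<close> is also the numerator of the ratio of
    \<open>lead_fac l n\<close> to \<open>lead_fac l m\<close>, so it cancels.\<close>
  also have "1 - s^2 * N^2 = h * i"
    by (simp add: h_def i_def N_def M_def Suc power2_eq_square algebra_simps)
  finally have b: "b_coeff l n = - (z * s * qq * (1 - N^2) * (h * i) / (g^2 * d * e^2 * f))" .
  have lead: "lead_fac l n = - (h * i / (qq*g*d*e)) * lead_fac l m"
    unfolding Suc lead_fac_Suc by (simp add: h_def i_def d_def e_def g_def y s_def M_def)
  have nm: "n - 1 = m"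
    using Suc by simp
  have *: "N^2 * s^2 = z * s * qq^2"
    by (simp add: y N_def M_def Suc power2_eq_square)
  show ?thesis
    unfolding nm lead b * g_def [symmetric] e_def [symmetric] f_def [symmetric]
    using nz by (simp add: power2_eq_square) (simp add: ac_simps)
qed

text \<open>
  The common factor of the four coefficients \<open>R_coeff l (n + 1) (k + 1)\<close>, \<open>R_coeff l n (k + 1)\<close>,
  \<open>R_coeff l n k\<close> and \<open>R_coeff l (n - 1) (k + 1)\<close> of the three-term recurrence; dividing by it
  leaves an identity of rational functions in \<open>q\<close>, \<open>q ^ l\<close>, \<open>q ^ n\<close> and \<open>q ^ k\<close>.
\<close>

definition base_term :: "nat \<Rightarrow> nat \<Rightarrow> nat \<Rightarrow> rat poly fract" where
  "base_term l n k = qpoch (inverse qq ^ n) qq k * qpoch (- (qq ^ (n + l + 1))) qq k /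
     (qpoch qq qq (Suc k) * qpoch (qq ^ (l + 1)) qq (Suc k)) * qq ^ k"

lemma R_coeff_base:
  "R_coeff l n k = (1 - qq * qq ^ k) * (1 - qq ^ l * qq * qq ^ k) * base_term l n k"
proof -
  have nz: "1 - qq * qq ^ k \<noteq> 0" "1 - qq ^ (l + 1) * qq ^ k \<noteq> 0"
    using one_minus_qq_power_nonzero[of k] one_minus_qq_power_nonzero[of "l + k"]
    by (simp_all add: power_add mult.assoc)
  have "qq ^ l * qq = qq ^ (l + 1)"
    by simp
  then show ?thesis
    unfolding R_coeff_def base_term_def qpoch_Suc using nz by (simp del: power_Suc power_Suc2)
qed

lemma R_coeff_Suc_base:
  "R_coeff l n (Suc k) =
     qq * (1 - qq ^ k / qq ^ n) * (1 + qq ^ n * qq ^ l * qq * qq ^ k) * base_term l n k"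
proof -
  have "1 - inverse qq ^ n * qq ^ k = 1 - qq ^ k / qq ^ n"
    by (simp add: divide_inverse power_inverse mult.commute)
  moreover have "1 - - (qq ^ (n + l + 1)) * qq ^ k = 1 + qq ^ n * qq ^ l * qq * qq ^ k"
    by (simp add: power_add ac_simps)
  ultimately have "qpoch (inverse qq ^ n) qq (Suc k) = qpoch (inverse qq ^ n) qq k * (1 - qq ^ k / qq ^ n)"
    "qpoch (- (qq ^ (n + l + 1))) qq (Suc k) =
       qpoch (- (qq ^ (n + l + 1))) qq k * (1 + qq ^ n * qq ^ l * qq * qq ^ k)"
    by (simp_all only: qpoch_Suc)
  then show ?thesis
    unfolding R_coeff_def base_term_def by (simp only: power_Suc) (simp add: ac_simps)
qed

text \<open>The product is treated as a whole because the denominator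
  \<open>i = 1 + q ^ (n + l + 1)\<close> of the coefficient cancels against the ratio of the
  prefactors.\<close>

lemma lead_fac_R_coeff_Suc_Suc:
  fixes l n k :: nat
  defines "s \<equiv> qq ^ l" and "N \<equiv> qq ^ n" and "K \<equiv> qq ^ k" and "y \<equiv> qq ^ (2 * n + l)"
  shows "lead_fac l (Suc n) * R_coeff l (Suc n) (Suc k) =
    - ((1 - s*qq*N) * (1 - 1/(N*qq)) * (1 + N*s*qq*K) * (1 + N*s*qq^2*K) /
        ((1-qq)*(1+y*qq)*(1+y*qq^2))) * (lead_fac l n * base_term l n k)"
proof -
  define A where "A = - (qq ^ (n + l + 1))"
  define i where "i = 1 + s*qq*N"
  have A: "1 - A = i" "1 - A * qq ^ k = 1 + N*s*qq*K" "1 - A * qq ^ Suc k = 1 + N*s*qq^2*K"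
    "- (qq ^ (Suc n + l + 1)) = A * qq"
    by (simp_all add: A_def i_def s_def N_def K_def power_add power2_eq_square ac_simps)
  have i: "i \<noteq> 0"
    using one_plus_qq_power_nonzero[of "n + l + 1"] by (simp add: i_def s_def N_def power_add ac_simps)
  have y: "y = N^2*s"
    by (simp add: y_def s_def N_def power_add power_mult power2_eq_square ac_simps flip: power_mult_distrib)
  have v: "qpoch (A * qq) qq (Suc k) = qpoch A qq k * (1 + N*s*qq*K) * (1 + N*s*qq^2*K) / i"
    using qpoch_shift2[of A qq k] i unfolding A by (simp add: eq_divide_eq mult.commute)
  have u: "qpoch (inverse qq ^ Suc n) qq (Suc k) = (1 - 1/(N*qq)) * qpoch (inverse qq ^ n) qq k"
  proof -
    have "inverse qq ^ Suc n * qq = inverse qq ^ n" "inverse qq ^ Suc n = 1/(N*qq)"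
      by (simp_all add: N_def field_simps)
    then show ?thesis
      by (simp only: qpoch_rec)
  qed
  have "R_coeff l (Suc n) (Suc k) = (1 - 1/(N*qq)) * qpoch (inverse qq ^ n) qq k *
      (qpoch A qq k * (1 + N*s*qq*K) * (1 + N*s*qq^2*K) / i) /
      (qpoch qq qq (Suc k) * qpoch (qq ^ (l + 1)) qq (Suc k)) * qq ^ Suc k"
    unfolding R_coeff_def A u v ..
  also have "\<dots> = qq * (1 - 1/(N*qq)) * (1 + N*s*qq*K) * (1 + N*s*qq^2*K) / i * base_term l n k"
    unfolding base_term_def A_def [symmetric] by (simp only: power_Suc) (simp add: ac_simps)
  finally have R: "R_coeff l (Suc n) (Suc k) =
      qq * (1 - 1/(N*qq)) * (1 + N*s*qq*K) * (1 + N*s*qq^2*K) / i * base_term l n k" .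
  have L: "lead_fac l (Suc n) =
     - ((1 - s*qq*N) * i / (qq*(1-qq)*(1+y*qq)*(1+y*qq^2))) * lead_fac l n"
    unfolding lead_fac_Suc y by (simp add: i_def s_def N_def)
  show ?thesis
    unfolding R L using i by simp (simp add: ac_simps)
qed

text \<open>The factor \<open>N * (1 - N^2)\<close> is supplied by \<open>b_coeff_lead_fac\<close>;
  it clears the \<open>1 - 1 / N\<close> that passing from \<open>q^(-n)\<close> to
  \<open>q^(1-n)\<close> puts into the denominator.\<close>

lemma R_coeff_pred:
  fixes l n k :: nat
  defines "s \<equiv> qq ^ l" and "N \<equiv> qq ^ n" and "K \<equiv> qq ^ k"
  shows "N * (1 - N^2) * R_coeff l (n - 1) (Suc k) =
    - (qq * (N - K) * (N - qq*K) * (1 + N) * (1 + s*N) * base_term l n k)"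
proof (cases n)
  case 0
  \<comment> \<open>Here \<open>N = 1\<close> makes the left side zero; on the right
    \<open>N - K\<close> vanishes for \<open>k = 0\<close>, and \<open>base_term\<close> for
    \<open>k > 0\<close>.\<close>
  then show ?thesis
    by (cases k) (simp_all add: N_def K_def base_term_def qpoch_rec)
next
  case (Suc m)
  define u where "u = qpoch (inverse qq ^ n) qq k"
  define v where "v = qpoch (- (qq ^ (n + l + 1))) qq k"
  define e where "e = qpoch qq qq (Suc k) * qpoch (qq ^ (l + 1)) qq (Suc k)"
  have N: "N \<noteq> 0" "N \<noteq> 1"
    by (simp_all add: N_def Suc del: power_Suc)
  have inv: "inverse qq ^ n * qq = inverse qq ^ m" "inverse qq ^ n = 1 / N"
    by (simp_all add: N_def Suc field_simps)
  have "(1 - 1 / N) * qpoch (inverse qq ^ m) qq (Suc k) = u * (1 - K / N) * (1 - qq * K / N)"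
    using qpoch_shift2[of "inverse qq ^ n" qq k, unfolded inv(1)] unfolding inv(2) u_def K_def by simp
  then have "(1 - 1 / N) * qpoch (inverse qq ^ m) qq (Suc k) * N^2 = u * (N - K) * (N - qq * K)"
    using N by (simp add: field_simps power2_eq_square)
  moreover have "N * (1 - N^2) = - ((1 + N) * ((1 - 1 / N) * N^2))"
    using N by (simp add: field_simps power2_eq_square)
  ultimately have u': "N * (1 - N^2) * qpoch (inverse qq ^ m) qq (Suc k) =
      - ((1 + N) * (u * (N - K) * (N - qq * K)))"
    by algebra
  have v': "qpoch (- (qq ^ (m + l + 1))) qq (Suc k) = (1 + s * N) * v"
  proof -
    have "- (qq ^ (m + l + 1)) * qq = - (qq ^ (n + l + 1))" "1 - - (qq ^ (m + l + 1)) = 1 + s * N"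
      by (simp_all add: Suc s_def N_def power_add ac_simps)
    then show ?thesis
      by (simp only: qpoch_rec v_def)
  qed
  have nm: "n - 1 = m"
    by (simp add: Suc)
  have "N * (1 - N^2) * R_coeff l (n - 1) (Suc k) =
      N * (1 - N^2) * qpoch (inverse qq ^ m) qq (Suc k) * ((1 + s * N) * v) / e * (qq * K)"
    unfolding nm R_coeff_def v' e_def K_def by (simp only: power_Suc times_divide_eq_right times_divide_eq_left mult.assoc)
  also have "\<dots> = - (qq * (N - K) * (N - qq*K) * (1 + N) * (1 + s*N) * base_term l n k)"
    unfolding u' base_term_def u_def [symmetric] v_def [symmetric] e_def [symmetric] K_def [symmetric]
    by simp
  finally show ?thesis .
qed

section \<open>Coefficient comparison in the basis \<open>phi_poly\<close>\<close>

lemma a_coeff_eq: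
  fixes l n k :: nat
  defines "s \<equiv> qq ^ l" and "y \<equiv> qq ^ (2 * n + l)"
  shows "a_coeff l n = y*(1+qq)*(1+s) / ((1-qq)*(1+y)*(1+y*qq^2)) - 1 / (1-qq)"
  by (simp add: a_coeff_def s_def y_def power_add power2_eq_square)

text \<open>All terms are multiples of \<open>T = lead_fac l n * base_term l n k\<close>, and the
  cofactors satisfy \<open>three_term_frac\<close>.\<close>

lemma coeff_recurrence_Suc:
  "lead_fac l (Suc n) * R_coeff l (Suc n) (Suc k) =
     (a_coeff l n + (1 - 1 / qq ^ (k + 2)) / (1 - qq)) * (lead_fac l n * R_coeff l n (Suc k))
     + 1 / qq ^ (k + 1) / (1 - qq) * (lead_fac l n * R_coeff l n k)
     - b_coeff l n * (lead_fac l (n - 1) * R_coeff l (n - 1) (Suc k))"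
proof -
  define s N K y where "s = qq ^ l" and "N = qq ^ n" and "K = qq ^ k" and "y = qq ^ (2 * n + l)"
  define T where "T = lead_fac l n * base_term l n k"
  have y: "y = N^2*s"
    by (simp add: y_def s_def N_def power_add power_mult power2_eq_square ac_simps flip: power_mult_distrib)
  have nz: "qq \<noteq> 0" "N \<noteq> 0" "K \<noteq> 0" "1 - qq \<noteq> 0" "1 + y \<noteq> 0" "1 + y*qq \<noteq> 0" "1 + y*qq^2 \<noteq> 0"
    using one_plus_qq_power_nonzero[of "2 * n + l"] one_plus_qq_power_nonzero[of "2 * n + l + 1"]
      one_plus_qq_power_nonzero[of "2 * n + l + 2"]
    by (simp_all add: N_def K_def y_def power_add power2_eq_square ac_simps)
  have "b_coeff l n * (lead_fac l (n - 1) * R_coeff l (n - 1) (Suc k)) =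
      N * s^2 / ((1-qq)*(1+y)*(1+y*qq)) * lead_fac l n * (N * (1-N^2) * R_coeff l (n - 1) (Suc k))"
    unfolding mult.assoc[symmetric] b_coeff_lead_fac
    by (simp add: s_def N_def y_def power2_eq_square ac_simps)
  also have "\<dots> = - (qq*N*s^2*(N-K)*(N-qq*K)*(1+N)*(1+s*N) / ((1-qq)*(1+y)*(1+y*qq))) * T"
    unfolding N_def R_coeff_pred unfolding N_def [symmetric] s_def [symmetric] K_def [symmetric] T_def
    by simp
  finally have b: "b_coeff l n * (lead_fac l (n - 1) * R_coeff l (n - 1) (Suc k)) =
      - (qq*N*s^2*(N-K)*(N-qq*K)*(1+N)*(1+s*N) / ((1-qq)*(1+y)*(1+y*qq))) * T" .
  have 1: "lead_fac l n * R_coeff l n k = (1-qq*K)*(1-s*qq*K) * T"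
    by (simp add: R_coeff_base T_def K_def s_def)
  have 2: "lead_fac l n * R_coeff l n (Suc k) = (qq*(1-K/N)*(1 + N*s*qq*K)) * T"
    by (simp add: R_coeff_Suc_base T_def K_def s_def N_def)
  have 3: "lead_fac l (Suc n) * R_coeff l (Suc n) (Suc k) =
    - ((1 - s*qq*N) * (1 - 1/(N*qq)) * (1 + N*s*qq*K) * (1 + N*s*qq^2*K) /
        ((1-qq)*(1+y*qq)*(1+y*qq^2))) * T"
    unfolding lead_fac_R_coeff_Suc_Suc by (simp add: T_def K_def s_def N_def y_def)
  have 4: "qq ^ (k + 2) = qq^2*K" "qq ^ (k + 1) = qq * K"
    by (simp_all add: K_def power_add power2_eq_square)
  show ?thesis
    unfolding a_coeff_eq b 1 2 3 4 three_term_frac[OF y nz] unfolding s_def [symmetric] y_def [symmetric]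
    by (simp only: distrib_right left_diff_distrib mult.assoc)
qed

text \<open>Separate from the previous identity, as index 0 receives no contribution from a lower
  basis element.\<close>

lemma coeff_recurrence_0:
  "lead_fac l (Suc n) * R_coeff l (Suc n) 0 =
     (a_coeff l n + (1 - 1 / qq) / (1 - qq)) * (lead_fac l n * R_coeff l n 0)
     - b_coeff l n * (lead_fac l (n - 1) * R_coeff l (n - 1) 0)"
proof -
  define s N y where "s = qq ^ l" and "N = qq ^ n" and "y = qq ^ (2 * n + l)"
  have y: "y = N^2*s"
    by (simp add: y_def s_def N_def power_add power_mult power2_eq_square ac_simps flip: power_mult_distrib)
  have nz: "qq \<noteq> 0" "1 - qq \<noteq> 0" "1 + y \<noteq> 0" "1 + y*qq \<noteq> 0" "1 + y*qq^2 \<noteq> 0"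
    using one_plus_qq_power_nonzero[of "2 * n + l"] one_plus_qq_power_nonzero[of "2 * n + l + 1"]
      one_plus_qq_power_nonzero[of "2 * n + l + 2"]
    by (simp_all add: y_def power_add power2_eq_square ac_simps)
  have R0: "R_coeff l m 0 = 1" for m
    by (simp add: R_coeff_def)
  show ?thesis
    unfolding R0 mult_1_right b_coeff_lead_fac lead_fac_Suc a_coeff_eq
    using three_term_frac_0[OF y nz]
    unfolding s_def [symmetric] N_def [symmetric] y_def [symmetric] y [symmetric]
    by (simp only: left_diff_distrib)
qed

text \<open>Substitute \<open>z = (1 - w) / (1 - q)\<close> and use
  \<open>W_phi_poly\<close>.\<close>

lemma linear_mult_phi_poly:
  "[:a, 1:] * phi_poly k =
     smult (a + (1 - 1 / qq ^ Suc k) / (1 - qq)) (phi_poly k)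
     + smult (1 / qq ^ Suc k / (1 - qq)) (phi_poly (Suc k))"
proof -
  have "(qq - 1) / (1 - qq) = - 1"
    by (simp add: divide_eq_eq)
  then have "[:a, 1:] = [:a + 1 / (1 - qq):] - smult (1 / (1 - qq)) W_poly"
    by (simp add: W_poly_def)
  then have "[:a, 1:] * phi_poly k =
      smult (a + 1 / (1 - qq)) (phi_poly k) - smult (1 / (1 - qq)) (W_poly * phi_poly k)"
    by (simp add: left_diff_distrib)
  also have "\<dots> = smult (a + (1 - 1 / qq ^ Suc k) / (1 - qq)) (phi_poly k)
     + smult (1 / qq ^ Suc k / (1 - qq)) (phi_poly (Suc k))"
    unfolding W_phi_poly
    by (simp add: smult_diff_right smult_diff_left smult_add_left diff_divide_distrib mult.commute del: power_Suc)
  finally show ?thesis .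
qed

text \<open>
  For \<open>n = 0\<close> the truncated \<open>n - 1\<close> is harmless because \<open>b_coeff l 0 = 0\<close>.
\<close>

lemma P_poly_recurrence:
  "P_poly l (Suc n) = [:a_coeff l n, 1:] * P_poly l n - smult (b_coeff l n) (P_poly l (n - 1))"
proof -
  define c where "c n k = lead_fac l n * R_coeff l n k" for n k
  define \<alpha> where "\<alpha> k = a_coeff l n + (1 - 1 / qq ^ Suc k) / (1 - qq)" for k
  define \<beta> where "\<beta> k = 1 / qq ^ Suc k / (1 - qq)" for k
  have lin: "[:a_coeff l n, 1:] * phi_poly k = smult (\<alpha> k) (phi_poly k) + smult (\<beta> k) (phi_poly (Suc k))" for k
    unfolding linear_mult_phi_poly \<alpha>_def \<beta>_def ..
  have P: "P_poly l m = (\<Sum>k\<le>M. smult (c m k) (phi_poly k))" if "m \<le> M" for m M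
    unfolding c_def by (rule P_poly_eq_sum_phi[OF that])
  have c0: "c (Suc n) 0 = \<alpha> 0 * c n 0 - b_coeff l n * c (n - 1) 0"
    using coeff_recurrence_0[of l n] by (simp add: c_def \<alpha>_def)
  have cS: "c (Suc n) (Suc k) = \<alpha> (Suc k) * c n (Suc k) + \<beta> k * c n k - b_coeff l n * c (n - 1) (Suc k)" for k
    using coeff_recurrence_Suc[of l n k] by (simp add: c_def \<alpha>_def \<beta>_def)
  \<comment> \<open>This lets the diagonal sum run to \<open>n + 1\<close>, like the other
    sums.\<close>
  have "c n (Suc n) = 0"
    by (simp add: c_def R_coeff_def qpoch_inverse_power_eq_0 del: power_inverse)
  then have lhs: "[:a_coeff l n, 1:] * P_poly l n =
      (\<Sum>k\<le>Suc n. smult (\<alpha> k * c n k) (phi_poly k)) + (\<Sum>k\<le>n. smult (\<beta> k * c n k) (phi_poly (Suc k)))"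
    unfolding P[OF le_refl] sum_distrib_left mult_smult_right lin
    by (simp add: smult_add_right sum.distrib mult.commute)
  have rhs: "smult (b_coeff l n) (P_poly l (n - 1)) =
      (\<Sum>k\<le>Suc n. smult (b_coeff l n * c (n - 1) k) (phi_poly k))"
    by (subst P[of "n - 1" "Suc n"]) (simp_all add: smult_sum_right smult_add_right)
  show ?thesis
    unfolding lhs rhs P[OF le_refl, of "Suc n"] sum.atMost_Suc_shift c0 cS
    by (simp add: smult_add_left smult_diff_left sum.distrib sum_subtractf)
qed

lemma P_poly_0 [simp]: "P_poly l 0 = 1"
  by (simp add: P_poly_def)

lemma P_poly_eq_favard_rec: "P_poly l n = favard_rec (a_coeff l) (b_coeff l) n"
proof (induction "a_coeff l" "b_coeff l" n rule: favard_rec.induct)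
  case 1
  then show ?case
    by simp
next
  case 2
  then show ?case
    using P_poly_recurrence[of l 0] by (simp add: b_coeff_def)
next
  case (3 n)
  then show ?case
    using P_poly_recurrence[of l "Suc n"] by simp
qed

subsection \<open>Moments of the q-Euler numbers\<close>

text \<open>Pascal's rule: the sum is an iterated finite difference of \<open>f\<close>.\<close>

lemma alternating_binomial_sum_Suc:
  fixes f :: "nat \<Rightarrow> 'a::comm_ring_1"
  shows "(\<Sum>k\<le>Suc n. (-1) ^ k * of_nat (Suc n choose k) * f k) =
     (\<Sum>k\<le>n. (-1) ^ k * of_nat (n choose k) * (f k - f (Suc k)))"
proof -
  have "(\<Sum>k\<le>Suc n. (-1) ^ k * of_nat (Suc n choose k) * f k) =
      f 0 + (\<Sum>k\<le>n. (-1) ^ Suc k * of_nat (n choose Suc k) * f (Suc k))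
        - (\<Sum>k\<le>n. (-1) ^ k * of_nat (n choose k) * f (Suc k))"
    by (subst sum.atMost_Suc_shift) (simp add: algebra_simps sum.distrib sum_negf sum_subtractf)
  also have "f 0 + (\<Sum>k\<le>n. (-1) ^ Suc k * of_nat (n choose Suc k) * f (Suc k)) =
      (\<Sum>k\<le>Suc n. (-1) ^ k * of_nat (n choose k) * f k)"
    by (subst sum.atMost_Suc_shift) simp
  finally show ?thesis
    by (simp add: right_diff_distrib sum_subtractf binomial_eq_0)
qed

lemma W_poly_mult: "W_poly * p = p - smult (1 - qq) (pCons 0 p)"
proof -
  have W: "W_poly = 1 - smult (1 - qq) [:0, 1:]"
    by (simp add: W_poly_def one_pCons)
  show ?thesis
    unfolding W left_diff_distrib by simp
qed

text \<open>The mixed moments make induction on \<open>m\<close> possible, since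
  \<open>w = 1 - (1 - q) z\<close> raises the power of \<open>z\<close>. The case
  \<open>n = 0\<close> gives \<open>L(w ^ m)\<close>.\<close>

lemma moment_monom_W_power:
  "moment_fun q_euler (monom 1 n * W_poly ^ m) =
     1 / (1 - qq) ^ n * (\<Sum>k\<le>n. (-1) ^ k * of_nat (n choose k) * ((1 + qq) / (1 + qq ^ (k + m + 1))))"
proof (induction m arbitrary: n)
  case 0
  then show ?case
    by (simp add: q_euler_def)
next
  case (Suc m)
  have "monom 1 n * W_poly = monom 1 n - smult (1 - qq) (monom 1 (Suc n))"
    by (simp add: W_poly_mult monom_Suc mult.commute)
  then have "monom 1 n * W_poly ^ Suc m =
      monom 1 n * W_poly ^ m - smult (1 - qq) (monom 1 (Suc n) * W_poly ^ m)"
    by (simp add: left_diff_distrib flip: mult.assoc)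
  moreover have "1 / (1 - qq) ^ n * (\<Sum>k\<le>n. (-1) ^ k * of_nat (n choose k) * ((1 + qq) / (1 + qq ^ (k + m + 1))))
      - (1 - qq) * (1 / (1 - qq) ^ Suc n *
          (\<Sum>k\<le>Suc n. (-1) ^ k * of_nat (Suc n choose k) * ((1 + qq) / (1 + qq ^ (k + m + 1)))))
    = 1 / (1 - qq) ^ n *
        (\<Sum>k\<le>n. (-1) ^ k * of_nat (n choose k) * ((1 + qq) / (1 + qq ^ (k + Suc m + 1))))"
    unfolding alternating_binomial_sum_Suc
    by (simp add: right_diff_distrib sum_subtractf diff_divide_distrib)
  ultimately show ?case
    by (simp only: moment_fun_diff moment_fun_smult Suc.IH)
qed

text \<open>Induction on \<open>k\<close> with \<open>m\<close> free, because
  \<open>phi_poly_Suc\<close> brings in a further factor \<open>w\<close>.\<close>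

lemma moment_W_power_phi:
  "moment_fun q_euler (W_poly ^ m * phi_poly k) =
     (1 + qq) * qpoch qq qq k / qpoch (- (qq ^ Suc m)) qq (Suc k)"
proof (induction k arbitrary: m)
  case 0
  show ?case
    using moment_monom_W_power[of 0 m] by (simp add: phi_poly_def qpoch_Suc)
next
  case (Suc k)
  define B where "B = - (qq ^ Suc m)"
  \<comment> \<open>Common denominator of both induction hypotheses: splitting it at the back gives
    the one for \<open>m\<close>, at the front the one for \<open>m + 1\<close>.\<close>
  define D where "D = qpoch B qq (Suc (Suc k))"
  have B: "1 - B \<noteq> 0" "1 - B * qq ^ Suc k \<noteq> 0"
    using one_plus_qq_power_nonzero[of "Suc m"] one_plus_qq_power_nonzero[of "Suc m + Suc k"]
    by (simp_all only: B_def power_add diff_minus_eq_add mult_minus_left not_False_eq_True)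
  have Bq: "- (qq ^ Suc (Suc m)) = B * qq"
    by (simp add: B_def)
  have D1: "D = (1 - B) * qpoch (B * qq) qq (Suc k)"
    by (simp only: D_def qpoch_rec)
  have D2: "D = qpoch B qq (Suc k) * (1 - B * qq ^ Suc k)"
    by (simp only: D_def qpoch_Suc)
  have IH: "moment_fun q_euler (W_poly ^ m * phi_poly k) =
      (1 + qq) * qpoch qq qq k * (1 - B * qq ^ Suc k) / D"
    unfolding D2 Suc.IH B_def [symmetric] using B by simp
  have IH': "moment_fun q_euler (W_poly ^ Suc m * phi_poly k) =
      (1 + qq) * qpoch qq qq k * (1 - B) / D"
    unfolding D1 Suc.IH Bq using B by simp
  have "W_poly ^ m * phi_poly (Suc k) =
      W_poly ^ m * phi_poly k - smult (qq ^ Suc k) (W_poly ^ Suc m * phi_poly k)"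
    by (simp add: phi_poly_Suc right_diff_distrib ac_simps)
  then have "moment_fun q_euler (W_poly ^ m * phi_poly (Suc k)) =
      (1 + qq) * qpoch qq qq k * ((1 - B * qq ^ Suc k) - qq ^ Suc k * (1 - B)) / D"
    by (simp only: moment_fun_diff moment_fun_smult IH IH')
      (simp add: right_diff_distrib diff_divide_distrib ac_simps)
  also have "(1 - B * qq ^ Suc k) - qq ^ Suc k * (1 - B) = 1 - qq * qq ^ k"
    by (simp add: algebra_simps)
  finally show ?case
    unfolding D_def B_def by (simp only: qpoch_Suc[of qq] mult.assoc)
qed

text \<open>Shifting the moments is multiplication by \<open>z = (1 - w) / (1 - q)\<close>.\<close>

lemma moment_q_euler_shift: "moment_fun (\<lambda>k. q_euler (k + 1)) p =
  (moment_fun q_euler p - moment_fun q_euler (W_poly * p)) / (1 - qq)"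
proof -
  have "pCons 0 p = smult (1 / (1 - qq)) (p - W_poly * p)"
    by (simp add: W_poly_mult)
  then show ?thesis
    using moment_fun_pCons[of q_euler 0 p] by simp
qed

text \<open>\<open>C\<close> depends on \<open>l\<close> and \<open>m\<close> but not on
  \<open>k\<close>, so it leaves the sum over \<open>k\<close>.\<close>

lemma moment_W_power_phi_shifted:
  assumes "l \<in> {0, 1}"
  obtains C where "\<And>k. moment_fun (\<lambda>k. q_euler (k + l)) (W_poly ^ m * phi_poly k) =
     C * (qpoch (qq ^ (l + 1)) qq k / qpoch (- (qq ^ (m + l + 2))) qq k)"
proof -
  define B where "B = - (qq ^ Suc m)"
  have B: "- (qq ^ Suc (Suc m)) = B * qq" "- (qq ^ (m + 2)) = B * qq"
    by (simp_all add: B_def power2_eq_square ac_simps)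
  have nz: "1 - B \<noteq> 0" "1 - B * qq \<noteq> 0"
    using one_plus_qq_power_nonzero[of "m + 1"] one_plus_qq_power_nonzero[of "m + 2"]
    by (simp_all add: B_def power2_eq_square ac_simps)
  consider "l = 0" | "l = 1"
    using assms by auto
  then show ?thesis
  proof cases
    case 1
    have "moment_fun (\<lambda>k. q_euler (k + l)) (W_poly ^ m * phi_poly k) =
      (1 + qq) / (1 - B) * (qpoch (qq ^ (l + 1)) qq k / qpoch (- (qq ^ (m + l + 2))) qq k)" for k
      using moment_W_power_phi[of m k] unfolding B_def [symmetric] qpoch_rec[of B]
      by (simp add: 1 B del: power_Suc)
    then show ?thesis
      by (rule that)
  next
    case 2
    have "moment_fun (\<lambda>k. q_euler (k + l)) (W_poly ^ m * phi_poly k) =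
      (1 + qq) * B / ((1 - B) * (1 - B * qq)) *
        (qpoch (qq ^ (l + 1)) qq k / qpoch (- (qq ^ (m + l + 2))) qq k)" for k
    proof -
      define D where "D = qpoch B qq (Suc (Suc k))"
      define Q where "Q = qpoch (qq * qq) qq k"
      have Q: "(1 - qq) * Q = qpoch qq qq k * (1 - qq * qq ^ k)"
        unfolding Q_def by (simp flip: qpoch_rec qpoch_Suc)
      have D1: "D = (1 - B) * qpoch (B * qq) qq (Suc k)"
        by (simp only: D_def qpoch_rec)
      have D2: "D = qpoch B qq (Suc k) * (1 - B * qq ^ Suc k)"
        by (simp only: D_def qpoch_Suc)
      have D3: "D = (1 - B) * (1 - B * qq) * qpoch (B * qq * qq) qq k"
        by (simp only: D_def qpoch_rec mult.assoc)
      have "1 - B * qq ^ Suc k \<noteq> 0"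
        using one_plus_qq_power_nonzero[of "Suc m + Suc k"]
        by (simp only: B_def power_add diff_minus_eq_add mult_minus_left not_False_eq_True)
      then have m0: "moment_fun q_euler (W_poly ^ m * phi_poly k) =
          (1 + qq) * qpoch qq qq k * (1 - B * qq ^ Suc k) / D"
        unfolding D2 moment_W_power_phi B_def [symmetric] by simp
      have m1: "moment_fun q_euler (W_poly ^ Suc m * phi_poly k) = (1 + qq) * qpoch qq qq k * (1 - B) / D"
        unfolding D1 moment_W_power_phi B using nz by simp
      have "moment_fun (\<lambda>k. q_euler (k + l)) (W_poly ^ m * phi_poly k) =
        (moment_fun q_euler (W_poly ^ m * phi_poly k)
          - moment_fun q_euler (W_poly ^ Suc m * phi_poly k)) / (1 - qq)"
        unfolding 2 moment_q_euler_shift by (simp add: mult.assoc)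
      also have "\<dots> = (1 + qq) * qpoch qq qq k * ((1 - B * qq ^ Suc k) - (1 - B)) / D / (1 - qq)"
        unfolding m0 m1 by (simp only: right_diff_distrib diff_divide_distrib)
      \<comment> \<open>The difference is \<open>B * (1 - q ^ (k + 1))\<close>, which completes
        \<open>(q; q)\<close> of length \<open>k\<close> to length \<open>k + 1\<close>, hence to
        \<open>(1 - q) * Q\<close>.\<close>
      also have "(1 + qq) * qpoch qq qq k * ((1 - B * qq ^ Suc k) - (1 - B)) =
          (1 + qq) * B * ((1 - qq) * Q)"
        unfolding Q by (simp add: algebra_simps)
      finally have "moment_fun (\<lambda>k. q_euler (k + l)) (W_poly ^ m * phi_poly k) =
          (1 + qq) * B * ((1 - qq) * Q) / D / (1 - qq)" .
      moreover have "qq ^ (l + 1) = qq * qq" "- (qq ^ (m + l + 2)) = B * qq * qq"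
        by (simp_all add: 2 B_def)
      ultimately show ?thesis
        unfolding D3 by (simp add: Q_def mult.assoc)
    qed
    then show ?thesis
      by (rule that)
  qed
qed

section \<open>Orthogonality of \<open>P_poly\<close>\<close>

lemma moment_W_power_P_poly:
  assumes l: "l \<in> {0, 1}" and "m < n"
  shows "moment_fun (\<lambda>k. q_euler (k + l)) (W_poly ^ m * P_poly l n) = 0"
proof -
  define b c where "b = - (qq ^ (n + l + 1))" and "c = - (qq ^ (m + l + 2))"
  obtain C where C: "\<And>k. moment_fun (\<lambda>k. q_euler (k + l)) (W_poly ^ m * phi_poly k) =
     C * (qpoch (qq ^ (l + 1)) qq k / qpoch c qq k)"
    using moment_W_power_phi_shifted[OF l] unfolding c_def by blast
  have "moment_fun (\<lambda>k. q_euler (k + l)) (W_poly ^ m * P_poly l n) =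
      (\<Sum>k\<le>n. lead_fac l n * R_coeff l n k * (C * (qpoch (qq ^ (l + 1)) qq k / qpoch c qq k)))"
    by (simp add: P_poly_eq_sum_phi[OF le_refl] sum_distrib_left moment_fun_sum C)
  \<comment> \<open>The symbol with base \<open>q ^ (l + 1)\<close> cancels between coefficient and
    moment, and the moment supplies the lower parameter \<open>c\<close>.\<close>
  also have "\<dots> = lead_fac l n * C * chu_sum qq n b c"
    unfolding chu_sum_def sum_distrib_left
  proof (intro sum.cong refl)
    fix k
    have "qpoch (qq ^ (l + 1)) qq k \<noteq> 0"
      using qpoch_qq_power_nonzero[of l k] by simp
    then show "lead_fac l n * R_coeff l n k * (C * (qpoch (qq ^ (l + 1)) qq k / qpoch c qq k)) =
      lead_fac l n * C * (qpoch (inverse qq ^ n) qq k * qpoch b qq k / (qpoch qq qq k * qpoch c qq k) * qq ^ k)"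
      unfolding R_coeff_def b_def [symmetric] by (simp add: ac_simps)
  qed
  also have "chu_sum qq n b c = (\<Prod>i<n. b - c * qq ^ i) / qpoch c qq n"
  proof (rule chu_vandermonde)
    show "c * qq ^ k \<noteq> 1" for k
      unfolding c_def by (rule minus_qq_power_mult_neq_1)
  qed (simp_all del: power_Suc)
  also have "(\<Prod>i<n. b - c * qq ^ i) = 0"
  proof (rule prod_zero)
    \<comment> \<open>Comparing the exponents \<open>n + l + 1\<close> and \<open>m + l + 2\<close>
      gives this index, which lies in the range since \<open>m < n\<close>.\<close>
    have "b - c * qq ^ (n - m - 1) = 0"
    proof -
      have e: "n + l + 1 = m + l + 2 + (n - m - 1)"
        using \<open>m < n\<close> by simp
      show ?thesis
        unfolding b_def c_def by (subst e) (simp add: power_add)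
    qed
    then show "\<exists>i\<in>{..<n}. b - c * qq ^ i = 0"
      using \<open>m < n\<close> by (intro bexI[of _ "n - m - 1"]) auto
  qed simp
  finally show ?thesis
    by simp
qed

text \<open>Passage from powers of \<open>w\<close> to powers of \<open>z\<close>: each step trades
  a factor \<open>z\<close> for \<open>(1 - w) / (1 - q)\<close>, so \<open>m\<close> must stay free
  in the induction.\<close>

lemma moment_monom_P_poly:
  assumes l: "l \<in> {0, 1}" and "j + m < n"
  shows "moment_fun (\<lambda>k. q_euler (k + l)) (monom 1 j * (W_poly ^ m * P_poly l n)) = 0"
  using \<open>j + m < n\<close>
proof (induction j arbitrary: m)
  case 0
  then show ?case
    using moment_W_power_P_poly[OF l] by simp
next
  case (Suc j)
  have "monom 1 (Suc j) = smult (1 / (1 - qq)) (monom 1 j - monom 1 j * W_poly)"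
    by (simp add: W_poly_mult monom_Suc mult.commute[of _ W_poly])
  then have "monom 1 (Suc j) * (W_poly ^ m * P_poly l n) = smult (1 / (1 - qq))
     (monom 1 j * (W_poly ^ m * P_poly l n) - monom 1 j * (W_poly ^ Suc m * P_poly l n))"
    by (simp add: left_diff_distrib mult.assoc)
  moreover have "j + m < n" "j + Suc m < n"
    using Suc.prems by auto
  ultimately show ?case
    by (simp only: Suc.IH moment_fun_smult moment_fun_diff diff_self mult_zero_right)
qed

theorem theorem5p2:
  fixes l :: nat
  assumes "l \<in> {0, 1}"
  shows "has_jacobi_cf (\<lambda>k. q_euler (k + l)) (a_coeff l) (b_coeff l)
       \<and> favard_polys (\<lambda>k. q_euler (k + l)) (P_poly l)"
proof -
  have "has_jacobi_cf (\<lambda>k. q_euler (k + l)) (a_coeff l) (b_coeff l)"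
  proof (rule has_jacobi_cf_if_orthogonal)
    fix n m :: nat
    assume "m < n"
    then show "moment_fun (\<lambda>k. q_euler (k + l)) (monom 1 m * favard_rec (a_coeff l) (b_coeff l) n) = 0"
      using moment_monom_P_poly[OF assms, of m 0 n] by (simp add: P_poly_eq_favard_rec)
  qed
  then show ?thesis
    by (auto simp: favard_polys_def P_poly_eq_favard_rec)
qed

end
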